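(* Let $N\ge 1$ and $K>N$ be integers and consider the caching problem with $N$ files and $K$ users, each equipped with a cache of the same (normalized) size $M$. Then the cache-rate pair $(M,R)=(1/K,\,N-N/K)$ is achievable. Furthermore, for every real $M\in[0,1/K]$, the cache-rate pair $(M,\,N(1-M))$ is achievable; that is, with cache size $M$ a peak delivery rate of at most $N(1-M)$ is achievable.
   Context: Caching problem with $N$ files and $K$ users. A server holds $N$ independent files $W_1,\dots,W_N$, each uniformly distributed on $\{0,1\}^F$ ($F$ bits per file). All $K$ users are connected to the server through one shared error-free link, so that every user receives everything the server transmits. Each user has a cache. The system works in two phases. Placement phase (before demands are known): user $k$ stores in its cache $Z_k=\varphi_k(W_1,\dots,W_N)$, where $\varphi_k$ is an arbitrary function. Delivery phase: each user $k$ requests one full file $W_{d_k}$; the demand vector $d=(d_1,\dots,d_K)\in\{1,\dots,N\}^K$ is arbitrary and known to the server and all users. The server broadcasts $X_d=\psi_d(W_1,\dots,W_N)$, and user $k$ forms an estimate $\hat W_{d,k}=\mu_{d,k}(X_d,Z_k)$ of $W_{d_k}$. The functions $\varphi_k,\psi_d,\mu_{d,k}$ form a caching scheme for file size $F$; its error probability is $\max_{d}\max_{k}\Pr(\hat W_{d,k}\neq W_{d_k})$. Cache sizes and rates are normalized by the file size. A cache-rate pair $(M,R)$ with $M,R\ge 0$ is called achievable if for every $\varepsilon>0$ and all sufficiently large $F$ there is a caching scheme for file size $F$ in which each $Z_k$ takes at most $2^{(M+\varepsilon)F}$ values, each $X_d$ (for every demand $d$) takes at most $2^{(R+\varepsilon)F}$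 values, and the error probability is less than $\varepsilon$. The rate $R$ is thus a peak (worst-case over demands) rate. *)

theory Defs
  imports "HOL-Probability.Probability" "HOL-Probability.Product_PMF"
begin

text \<open>
  Files are indexed by \<open>{1..N}\<close>, users by \<open>{1..K}\<close>. A library of files is a function
  \<open>W\<close> from file indices to bit strings, undefined outside \<open>{1..N}\<close>.
\<close>

definition bit_strings :: "nat \<Rightarrow> bool list set" where
  "bit_strings F = {w. length w = F}"

definition files_pmf :: "nat \<Rightarrow> nat \<Rightarrow> (nat \<Rightarrow> bool list) pmf" where
  "files_pmf N F = Pi_pmf {1..N} undefined (\<lambda>_. pmf_of_set (bit_strings F))"

definition demands :: "nat \<Rightarrow> nat \<Rightarrow> (nat \<Rightarrow> nat) set" where
  "demands N K = {1..K} \<rightarrow>\<^sub>E {1..N}"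

text \<open>
  A caching scheme consists of placement functions \<open>\<phi> k\<close>, delivery functions \<open>\<psi> d\<close>
  and decoding functions \<open>\<mu> d k\<close>. Cache contents and transmitted messages are encoded as
  natural numbers; only the number of values they take matters, and it is bounded separately
  in \<open>achievable\<close>.
\<close>

type_synonym placement = "nat \<Rightarrow> (nat \<Rightarrow> bool list) \<Rightarrow> nat"
type_synonym delivery = "(nat \<Rightarrow> nat) \<Rightarrow> (nat \<Rightarrow> bool list) \<Rightarrow> nat"
type_synonym decoding = "(nat \<Rightarrow> nat) \<Rightarrow> nat \<Rightarrow> nat \<Rightarrow> nat \<Rightarrow> bool list"

definition error_prob ::
  "nat \<Rightarrow> nat \<Rightarrow> nat \<Rightarrow> placement \<Rightarrow> delivery \<Rightarrow> decoding \<Rightarrow> real" where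
  "error_prob N K F \<phi> \<psi> \<mu> =
     (MAX d\<in>demands N K. MAX k\<in>{1..K}.
        measure_pmf.prob (files_pmf N F) {W. \<mu> d k (\<psi> d W) (\<phi> k W) \<noteq> W (d k)})"

text \<open>
  The support of \<open>files_pmf N F\<close> is the finite set of all libraries of \<open>N\<close> files of
  \<open>F\<close> bits (lemma \<open>set_files_pmf\<close> below), so the cardinalities here are those of finite sets.
\<close>

definition achievable :: "nat \<Rightarrow> nat \<Rightarrow> real \<Rightarrow> real \<Rightarrow> bool" where
  "achievable N K M R \<longleftrightarrow> M \<ge> 0 \<and> R \<ge> 0 \<and>
     (\<forall>\<epsilon>>0. \<exists>F\<^sub>0. \<forall>F\<ge>F\<^sub>0. \<exists>\<phi> \<psi> \<mu>.
        (\<forall>k\<in>{1..K}. real (card (\<phi> k ` set_pmf (files_pmf N F))) \<le> 2 powr ((M + \<epsilon>) * real F)) \<and>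
        (\<forall>d\<in>demands N K. real (card (\<psi> d ` set_pmf (files_pmf N F))) \<le> 2 powr ((R + \<epsilon>) * real F)) \<and>
        error_prob N K F \<phi> \<psi> \<mu> < \<epsilon>)"

lemma finite_bit_strings: "finite (bit_strings F)"
  using finite_lists_length_eq[of "UNIV :: bool set" F] by (simp add: bit_strings_def)

lemma bit_strings_nonempty: "bit_strings F \<noteq> {}"
  by (auto simp: bit_strings_def intro: exI[of _ "replicate F True"])

lemma set_files_pmf: "set_pmf (files_pmf N F) = {1..N} \<rightarrow>\<^sub>E bit_strings F"
  by (auto simp: files_pmf_def set_Pi_pmf PiE_dflt_def PiE_def Pi_def extensional_def
      set_pmf_of_set[OF bit_strings_nonempty finite_bit_strings])

lemma finite_set_files_pmf: "finite (set_pmf (files_pmf N F))"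
  unfolding set_files_pmf by (intro finite_PiE finite_atLeastAtMost finite_bit_strings)

end

theory Submission
  imports Defs
begin

text \<open>
  Let \<open>m = \<lfloor>M F\<rfloor>\<close> and cut the first \<open>K m\<close> bits of every file into \<open>K\<close> blocks of \<open>m\<close> bits, one
  block per user. User \<open>k\<close> caches the bitwise sum, over all files, of the \<open>k\<close>-th blocks. Suppose
  first that every file is requested, and choose for every file \<open>n\<close> a leader among the users
  requesting it. The server sends all bits of all files with one modification: in file \<open>n\<close>, the
  block of a user requesting \<open>n\<close> is sent as its sum with the leader's block. The leader's own block
  becomes zero and costs nothing, so \<open>N (F - m)\<close> bits are sent. User \<open>k\<close> sees the \<open>k\<close>-th block of
  every unrequested file in the clear, hence gets the \<open>k\<close>-th block of its own file from the cache,
  then the leader's block, then everything else. If some file is not requested, sending all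
  requested files uncoded takes at most \<open>(N - 1) F \<le> N (F - m)\<close> bits.
\<close>

subsection \<open>Zero-error schemes\<close>

text \<open>
  A decoder exists as soon as message and cache content together determine the requested file, so
  the contents may have arbitrary types and no decoder has to be constructed.
\<close>

lemma error_free_scheme_exists:
  fixes N K F :: nat
    and cache :: "nat \<Rightarrow> (nat \<Rightarrow> bool list) \<Rightarrow> 'a"
    and message :: "(nat \<Rightarrow> nat) \<Rightarrow> (nat \<Rightarrow> bool list) \<Rightarrow> 'b"
  defines "S \<equiv> set_pmf (files_pmf N F)"
  assumes "N \<ge> 1" "K \<ge> 1"
    and determined: "\<And>d k W W'. \<lbrakk>d \<in> demands N K; k \<in> {1..K}; W \<in> S; W' \<in> S;
      message d W = message d W'; cache k W = cache k W'\<rbrakk> \<Longrightarrow> W (d k) = W' (d k)"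
  obtains \<phi> \<psi> \<mu> where
    "\<And>k. card (\<phi> k ` S) = card (cache k ` S)"
    "\<And>d. card (\<psi> d ` S) = card (message d ` S)"
    "error_prob N K F \<phi> \<psi> \<mu> = 0"
proof -
  have finS: "finite S"
    unfolding S_def by (rule finite_set_files_pmf)
  define \<phi> where "\<phi> k W = to_nat_on (cache k ` S) (cache k W)" for k W
  define \<psi> where "\<psi> d W = to_nat_on (message d ` S) (message d W)" for d W
  \<comment> \<open>The decoder guesses any library consistent with what the user sees; by
    \<open>determined\<close> every such library has the right file \<open>d k\<close>.\<close>
  define \<mu> where "\<mu> d k x z = (SOME W. W \<in> S \<and> \<psi> d W = x \<and> \<phi> k W = z) (d k)" for d k x z
  have \<phi>_eq: "\<phi> k W = \<phi> k W' \<longleftrightarrow> cache k W = cache k W'" if "W \<in> S" "W' \<in> S" for k W W'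
    using that finS by (simp add: \<phi>_def countable_finite)
  have \<psi>_eq: "\<psi> d W = \<psi> d W' \<longleftrightarrow> message d W = message d W'" if "W \<in> S" "W' \<in> S" for d W W'
    using that finS by (simp add: \<psi>_def countable_finite)
  have "card (\<phi> k ` S) = card (cache k ` S)" for k
  proof -
    have "\<phi> k ` S = to_nat_on (cache k ` S) ` cache k ` S"
      by (simp add: \<phi>_def image_image)
    then show ?thesis
      using finS by (simp add: card_image inj_on_to_nat_on countable_finite)
  qed
  moreover have "card (\<psi> d ` S) = card (message d ` S)" for d
  proof -
    have "\<psi> d ` S = to_nat_on (message d ` S) ` message d ` S"
      by (simp add: \<psi>_def image_image)
    then show ?thesis
      using finS by (simp add: card_image inj_on_to_nat_on countable_finite)
  qed
  moreover have "error_prob N K F \<phi> \<psi> \<mu> = 0"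
  proof -
    have decode: "\<mu> d k (\<psi> d W) (\<phi> k W) = W (d k)"
      if "d \<in> demands N K" "k \<in> {1..K}" "W \<in> S" for d k W
    proof -
      define V where "V = (SOME V. V \<in> S \<and> \<psi> d V = \<psi> d W \<and> \<phi> k V = \<phi> k W)"
      have "V \<in> S \<and> \<psi> d V = \<psi> d W \<and> \<phi> k V = \<phi> k W"
        unfolding V_def by (rule someI[of _ W]) (use that in simp)
      then have "V (d k) = W (d k)"
        using that determined \<phi>_eq \<psi>_eq by metis
      then show ?thesis
        by (simp add: \<mu>_def V_def)
    qed
    have "measure_pmf.prob (files_pmf N F) {W. \<mu> d k (\<psi> d W) (\<phi> k W) \<noteq> W (d k)} = 0"
      if "d \<in> demands N K" "k \<in> {1..K}" for d k
      using decode[OF that] by (auto simp: measure_pmf_zero_iff S_def)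
    moreover have "finite (demands N K)"
      by (simp add: demands_def finite_PiE)
    moreover have "demands N K \<noteq> {}"
      using \<open>N \<ge> 1\<close> by (auto simp: demands_def PiE_eq_empty_iff)
    ultimately show ?thesis
      using \<open>K \<ge> 1\<close> by (simp add: error_prob_def image_constant_conv cong: image_cong_simp)
  qed
  ultimately show thesis
    using that by blast
qed

text \<open>Counts bit vectors encoded as sets: if \<open>I\<close> holds all positions that may
  carry a one, each position of \<open>I\<close> contributes one bit.\<close>

lemma card_image_le_power2:
  assumes "finite I" "card I \<le> b" "\<And>x. x \<in> A \<Longrightarrow> f x \<subseteq> I"
  shows "card (f ` A) \<le> 2 ^ b"
proof -
  have "card (f ` A) \<le> card (Pow I)"
    using assms by (intro card_mono) auto
  also have "\<dots> \<le> 2 ^ b"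
    using assms by (simp add: card_Pow)
  finally show ?thesis .
qed

subsection \<open>The coded scheme\<close>

text \<open>Bit vectors are encoded as the set of positions carrying a one.\<close>

definition cache_content :: "nat \<Rightarrow> nat \<Rightarrow> nat \<Rightarrow> (nat \<Rightarrow> bool list) \<Rightarrow> nat set" where
  "cache_content N m k W =
     {i \<in> {..<m}. odd (\<Sum>n\<in>{1..N}. of_bool (W n ! ((k - 1) * m + i)) :: nat)}"

text \<open>
  Position \<open>p < K m\<close> lies in the block of user \<open>Suc (p div m)\<close>; the leader of file \<open>n\<close> is
  \<open>inv_into {1..K} d n\<close>.
\<close>

definition coded_message ::
  "nat \<Rightarrow> nat \<Rightarrow> nat \<Rightarrow> nat \<Rightarrow> (nat \<Rightarrow> nat) \<Rightarrow> (nat \<Rightarrow> bool list) \<Rightarrow> (nat \<times> nat) set" where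
  "coded_message N K F m d W = {(n, p). n \<in> {1..N} \<and> p < F \<and>
     W n ! p \<noteq> (p < K * m \<and> d (Suc (p div m)) = n \<and>
                W n ! ((inv_into {1..K} d n - 1) * m + p mod m))}"

definition uncoded_message ::
  "nat \<Rightarrow> nat \<Rightarrow> (nat \<Rightarrow> nat) \<Rightarrow> (nat \<Rightarrow> bool list) \<Rightarrow> (nat \<times> nat) set" where
  "uncoded_message K F d W = {(n, p). n \<in> d ` {1..K} \<and> p < F \<and> W n ! p}"

definition broadcast ::
  "nat \<Rightarrow> nat \<Rightarrow> nat \<Rightarrow> nat \<Rightarrow> (nat \<Rightarrow> nat) \<Rightarrow> (nat \<Rightarrow> bool list) \<Rightarrow> (nat \<times> nat) set" where
  "broadcast N K F m d W =
     (if d ` {1..K} = {1..N} then coded_message N K F m d W else uncoded_message K F d W)"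

text \<open>The terms other than \<open>a\<close> contribute equally to both sums, so the parity is
  decided by the term at \<open>a\<close>. This is how a user extracts its own block from the cached
  sum.\<close>

lemma parity_sum_cancel:
  assumes "finite A" "a \<in> A" "\<And>x. x \<in> A - {a} \<Longrightarrow> f x = g x"
    and "odd (\<Sum>x\<in>A. of_bool (f x) :: nat) \<longleftrightarrow> odd (\<Sum>x\<in>A. of_bool (g x) :: nat)"
  shows "f a \<longleftrightarrow> g a"
proof -
  have "(\<Sum>x\<in>A - {a}. of_bool (f x) :: nat) = (\<Sum>x\<in>A - {a}. of_bool (g x))"
    using assms(3) by (intro sum.cong) auto
  then show ?thesis
    using assms(4) sum.remove[OF assms(1,2), of "\<lambda>x. of_bool (f x) :: nat"]
      sum.remove[OF assms(1,2), of "\<lambda>x. of_bool (g x) :: nat"]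
    by (auto split: if_splits)
qed

lemma card_cache_content_image: "card (cache_content N m k ` S) \<le> 2 ^ m"
  by (rule card_image_le_power2[where I = "{..<m}"]) (auto simp: cache_content_def)

lemma block_bound:
  fixes k i m K :: nat
  assumes "k \<in> {1..K}" "i < m"
  shows "(k - 1) * m + i < K * m"
proof -
  have "(k - 1) * m + i < Suc (k - 1) * m"
    using assms unfolding mult_Suc by linarith
  also have "\<dots> \<le> K * m"
    using assms by (intro mult_right_mono) auto
  finally show ?thesis .
qed

text \<open>Inside the leader's own block, the leader's position matching \<open>p\<close> is
  \<open>p\<close> itself, so the bit sent is the sum of a bit with itself and vanishes.\<close>

lemma coded_message_subset:
  assumes onto: "d ` {1..K} = {1..N}" and "K * m \<le> F"
  shows "coded_message N K F m d W \<subseteq>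
    (SIGMA n:{1..N}. {..<F} - {(inv_into {1..K} d n - 1) * m..<(inv_into {1..K} d n - 1) * m + m})"
proof -
  have False if n: "n \<in> {1..N}" and np: "(n, p) \<in> coded_message N K F m d W"
    and p: "(inv_into {1..K} d n - 1) * m \<le> p" "p < (inv_into {1..K} d n - 1) * m + m" for n p
  proof -
    define l where "l = inv_into {1..K} d n"
    have l: "l \<in> {1..K}" "d l = n"
      unfolding l_def using n onto by (blast intro: inv_into_into, blast intro: f_inv_into_f)
    obtain i where i: "p = (l - 1) * m + i" "i < m"
      using p nat_le_iff_add[of "(l - 1) * m" p] by (auto simp: l_def)
    have "p < K * m" "p div m = l - 1" "p mod m = i"
      using block_bound[OF l(1) i(2)] i by auto
    then show False
      using np l i by (simp add: coded_message_def l_def[unfolded One_nat_def, symmetric])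
  qed
  moreover have "n \<in> {1..N} \<and> p \<in> {..<F}" if "(n, p) \<in> coded_message N K F m d W" for n p
    using that by (simp add: coded_message_def)
  ultimately show ?thesis
    unfolding subset_iff split_paired_All mem_Sigma_iff Diff_iff atLeastLessThan_iff by blast
qed

lemma card_broadcast_image:
  assumes d: "d \<in> demands N K" and "K * m \<le> F" "N \<le> K"
  shows "card (broadcast N K F m d ` S) \<le> 2 ^ (N * (F - m))"
proof (cases "d ` {1..K} = {1..N}")
  case True
  let ?B = "\<lambda>n. {(inv_into {1..K} d n - 1) * m..<(inv_into {1..K} d n - 1) * m + m}"
  have "card ({..<F} - ?B n) = F - m" if "n \<in> {1..N}" for n
  proof -
    have "inv_into {1..K} d n \<in> {1..K}"
      using that True by (blast intro: inv_into_into)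
    then have "?B n \<subseteq> {..<F}"
      \<comment> \<open>The last bit of the leader's block has offset \<open>m - 1\<close>; an empty
        block is treated apart.\<close>
      using block_bound[of "inv_into {1..K} d n" K "m - 1" m] \<open>K * m \<le> F\<close>
      by (cases "m = 0") auto
    then show ?thesis
      by (simp add: card_Diff_subset)
  qed
  then have "card (SIGMA n:{1..N}. {..<F} - ?B n) = N * (F - m)"
    by (simp add: card_SigmaI)
  then show ?thesis
    using coded_message_subset[OF True \<open>K * m \<le> F\<close>] True
    by (intro card_image_le_power2[where I = "SIGMA n:{1..N}. {..<F} - ?B n"])
      (simp_all add: broadcast_def)
next
  case False
  have "d ` {1..K} \<subseteq> {1..N}"
    using d by (auto simp: demands_def)
  then have "d ` {1..K} \<subset> {1..N}"
    using False by blast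
  then have "card (d ` {1..K}) < N"
    using psubset_card_mono[of "{1..N}"] by simp
  then have "card (d ` {1..K}) \<le> N - 1"
    by simp
  have "N * m \<le> F"
    using mult_le_mono1[OF \<open>N \<le> K\<close>, of m] \<open>K * m \<le> F\<close> by (rule le_trans)
  have "card (d ` {1..K} \<times> {..<F}) \<le> (N - 1) * F"
    using \<open>card (d ` {1..K}) \<le> N - 1\<close> by (simp add: card_cartesian_product)
  \<comment> \<open>Expanded, this compares \<open>N * F - F\<close> with
    \<open>N * F - N * m\<close>, hence rests on \<open>N * m \<le> F\<close>.\<close>
  also have "\<dots> \<le> N * (F - m)"
    using \<open>N * m \<le> F\<close> by (simp add: diff_mult_distrib diff_mult_distrib2)
  finally show ?thesis
    using False
    by (intro card_image_le_power2[where I = "d ` {1..K} \<times> {..<F}"])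
      (auto simp: broadcast_def uncoded_message_def)
qed

lemma coded_message_determines_file:
  assumes onto: "d ` {1..K} = {1..N}" and "K * m \<le> F" and k: "k \<in> {1..K}"
    and msg: "coded_message N K F m d W = coded_message N K F m d W'"
    and cache: "cache_content N m k W = cache_content N m k W'"
    and "p < F"
  shows "W (d k) ! p \<longleftrightarrow> W' (d k) ! p"
proof -
  define n where "n = d k"
  have n: "n \<in> {1..N}"
    unfolding n_def using onto k by blast
  let ?lead = "\<lambda>n p. (inv_into {1..K} d n - 1) * m + p mod m"
  \<comment> \<open>Equality of messages read bit by bit; \<open>\<noteq>\<close> between truth
    values is addition modulo 2.\<close>
  have sent: "(W j ! q \<noteq> (q < K * m \<and> d (Suc (q div m)) = j \<and> W j ! ?lead j q)) \<longleftrightarrow>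
      (W' j ! q \<noteq> (q < K * m \<and> d (Suc (q div m)) = j \<and> W' j ! ?lead j q))"
    if "j \<in> {1..N}" "q < F" for j q
    using msg that unfolding coded_message_def set_eq_iff by blast
  have own: "W n ! ((k - 1) * m + i) \<longleftrightarrow> W' n ! ((k - 1) * m + i)" if "i < m" for i
  proof (rule parity_sum_cancel[of "{1..N}" n
        "\<lambda>n. W n ! ((k - 1) * m + i)" "\<lambda>n. W' n ! ((k - 1) * m + i)"])
    show "odd (\<Sum>n\<in>{1..N}. of_bool (W n ! ((k - 1) * m + i)) :: nat) \<longleftrightarrow>
        odd (\<Sum>n\<in>{1..N}. of_bool (W' n ! ((k - 1) * m + i)) :: nat)"
      using cache \<open>i < m\<close> unfolding cache_content_def set_eq_iff by blast
  next
    \<comment> \<open>User \<open>k\<close> requests \<open>n\<close>, not \<open>j\<close>, so its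
      block in file \<open>j\<close> is sent unmodified.\<close>
    fix j assume j: "j \<in> {1..N} - {n}"
    have "(k - 1) * m + i < K * m" "Suc (((k - 1) * m + i) div m) = k"
      using block_bound[OF k \<open>i < m\<close>] k \<open>i < m\<close> by auto
    then show "(W j ! ((k - 1) * m + i)) = (W' j ! ((k - 1) * m + i))"
      using sent[of j "(k - 1) * m + i"] j \<open>K * m \<le> F\<close> by (auto simp: n_def)
  qed (use n in auto)
  \<comment> \<open>Bit \<open>i\<close> of the block of \<open>k\<close> is sent as its sum with
    the leader's bit; as the former is known, so is the latter, also when \<open>k\<close> is the
    leader.\<close>
  have leader: "W n ! ((inv_into {1..K} d n - 1) * m + i) \<longleftrightarrow>
      W' n ! ((inv_into {1..K} d n - 1) * m + i)" if "i < m" for i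
  proof -
    have "(k - 1) * m + i < K * m" "Suc (((k - 1) * m + i) div m) = k"
      "((k - 1) * m + i) mod m = i"
      using block_bound[OF k \<open>i < m\<close>] k \<open>i < m\<close> by auto
    then show ?thesis
      using sent[of n "(k - 1) * m + i"] n own[OF that] \<open>K * m \<le> F\<close> by (auto simp: n_def)
  qed
  have "W n ! ?lead n p \<longleftrightarrow> W' n ! ?lead n p" if "p < K * m"
    using leader[of "p mod m"] that by (cases "m = 0") auto
  then show ?thesis
    \<comment> \<open>Whatever was added to bit \<open>p\<close> is now known and cancels.\<close>
    using sent[OF n \<open>p < F\<close>] by (auto simp flip: n_def)
qed

lemma broadcast_determines_file:
  assumes d: "d \<in> demands N K" and "K * m \<le> F" and k: "k \<in> {1..K}"
    and W: "W \<in> set_pmf (files_pmf N F)" and W': "W' \<in> set_pmf (files_pmf N F)"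
    and msg: "broadcast N K F m d W = broadcast N K F m d W'"
    and cache: "cache_content N m k W = cache_content N m k W'"
  shows "W (d k) = W' (d k)"
proof (rule nth_equalityI)
  have "d k \<in> {1..N}"
    using d k by (auto simp: demands_def)
  then have len: "length (W (d k)) = F" "length (W' (d k)) = F"
    using W W' by (auto simp: set_files_pmf bit_strings_def)
  then show "length (W (d k)) = length (W' (d k))"
    by simp
  fix p assume "p < length (W (d k))"
  then have "p < F"
    by (simp add: len)
  show "W (d k) ! p = W' (d k) ! p"
  proof (cases "d ` {1..K} = {1..N}")
    case True
    then show ?thesis
      using coded_message_determines_file[OF True \<open>K * m \<le> F\<close> k _ cache \<open>p < F\<close>] msg
      by (simp add: broadcast_def)
  next
    case False
    then have "(d k, p) \<in> uncoded_message K F d W \<longleftrightarrow> (d k, p) \<in> uncoded_message K F d W'"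
      using msg by (simp add: broadcast_def)
    then show ?thesis
      using k \<open>p < F\<close> by (auto simp: uncoded_message_def)
  qed
qed

subsection \<open>Rates\<close>

lemma achievable_small_cache:
  assumes "N \<ge> 1" "K \<ge> N" "0 \<le> M" "M \<le> 1 / real K"
  shows "achievable N K M (real N * (1 - M))"
  unfolding achievable_def
proof (intro conjI allI impI)
  have "real K \<ge> 1"
    using assms by simp
  then have "M \<le> 1"
    using assms(4) by (smt (verit) divide_le_eq_1_pos)
  then show "0 \<le> real N * (1 - M)"
    by simp
  show "0 \<le> M"
    by fact
  fix \<epsilon> :: real assume "\<epsilon> > 0"
  show "\<exists>F\<^sub>0. \<forall>F\<ge>F\<^sub>0. \<exists>\<phi> \<psi> \<mu>.
     (\<forall>k\<in>{1..K}. real (card (\<phi> k ` set_pmf (files_pmf N F))) \<le> 2 powr ((M + \<epsilon>) * real F)) \<and>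
     (\<forall>d\<in>demands N K. real (card (\<psi> d ` set_pmf (files_pmf N F)))
        \<le> 2 powr ((real N * (1 - M) + \<epsilon>) * real F)) \<and>
     error_prob N K F \<phi> \<psi> \<mu> < \<epsilon>"
  \<comment> \<open>Rounding \<open>M * F\<close> down to \<open>m\<close> costs at most one extra
    transmitted bit per file; these \<open>N\<close> bits fit into \<epsilon>F once F \<ge>
    N/\<epsilon>.\<close>
  proof (rule exI[of _ "nat \<lceil>real N / \<epsilon>\<rceil>"], intro allI impI)
    fix F assume "F \<ge> nat \<lceil>real N / \<epsilon>\<rceil>"
    then have "real N / \<epsilon> \<le> real F"
      by linarith
    then have NF: "real N \<le> \<epsilon> * real F"
      using \<open>\<epsilon> > 0\<close> by (simp add: divide_le_eq mult.commute)
    define m where "m = nat \<lfloor>M * real F\<rfloor>"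
    have m: "real m \<le> M * real F" "M * real F - 1 \<le> real m"
      using \<open>0 \<le> M\<close> by (auto simp: m_def intro: of_nat_floor)
    have "real K * real m \<le> real K * (M * real F)"
      using m by (intro mult_left_mono) auto
    also have "\<dots> = M * real K * real F"
      by simp
    \<comment> \<open>The only place where M \<le> 1/K limits the block length: the K blocks must
      fit into one file.\<close>
    also have "\<dots> \<le> 1 * real F"
      using assms(4) \<open>real K \<ge> 1\<close> by (intro mult_right_mono) (simp_all add: pos_le_divide_eq)
    finally have Km: "K * m \<le> F"
      by (simp flip: of_nat_mult)
    have "m \<le> F"
      using mult_le_mono1[of 1 K m] Km assms(1,2) by linarith
    obtain \<phi> \<psi> \<mu> where scheme:
      "\<And>k. card (\<phi> k ` set_pmf (files_pmf N F)) =
        card (cache_content N m k ` set_pmf (files_pmf N F))"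
      "\<And>d. card (\<psi> d ` set_pmf (files_pmf N F)) =
        card (broadcast N K F m d ` set_pmf (files_pmf N F))"
      "error_prob N K F \<phi> \<psi> \<mu> = 0"
    proof (rule error_free_scheme_exists[where N = N and K = K and F = F
          and message = "broadcast N K F m" and cache = "cache_content N m"])
      show "N \<ge> 1" "K \<ge> 1"
        using assms by auto
      show "W (d k) = W' (d k)"
        if "d \<in> demands N K" "k \<in> {1..K}"
          "W \<in> set_pmf (files_pmf N F)" "W' \<in> set_pmf (files_pmf N F)"
          "broadcast N K F m d W = broadcast N K F m d W'"
          "cache_content N m k W = cache_content N m k W'" for d k W W'
        using broadcast_determines_file[OF that(1) Km that(2-6)] .
    qed blast
    have "real (card (\<phi> k ` set_pmf (files_pmf N F))) \<le> 2 powr ((M + \<epsilon>) * real F)" for k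
    proof -
      have "real (card (\<phi> k ` set_pmf (files_pmf N F))) \<le> real (2 ^ m)"
        unfolding scheme of_nat_le_iff by (rule card_cache_content_image)
      also have "\<dots> = 2 powr real m"
        by (simp add: powr_realpow)
      also have "\<dots> \<le> 2 powr ((M + \<epsilon>) * real F)"
        using m \<open>\<epsilon> > 0\<close> by (intro powr_mono) (simp_all add: distrib_right add_increasing2)
      finally show ?thesis .
    qed
    moreover have "real (card (\<psi> d ` set_pmf (files_pmf N F)))
        \<le> 2 powr ((real N * (1 - M) + \<epsilon>) * real F)" if "d \<in> demands N K" for d
    proof -
      have "real (card (\<psi> d ` set_pmf (files_pmf N F))) \<le> real (2 ^ (N * (F - m)))"
        unfolding scheme of_nat_le_iff by (rule card_broadcast_image[OF that Km \<open>K \<ge> N\<close>])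
      also have "\<dots> = 2 powr (real N * (real F - real m))"
        using \<open>m \<le> F\<close> by (simp add: of_nat_diff flip: powr_realpow)
      also have "\<dots> \<le> 2 powr ((real N * (1 - M) + \<epsilon>) * real F)"
      proof (rule powr_mono)
        have "real N * (real F - real m) \<le> real N * (real F - (M * real F - 1))"
          using m by (intro mult_left_mono) auto
        also have "\<dots> = real N * (1 - M) * real F + real N"
          by (simp add: algebra_simps)
        also have "\<dots> \<le> (real N * (1 - M) + \<epsilon>) * real F"
          using NF by (simp add: distrib_right)
        finally show "real N * (real F - real m) \<le> (real N * (1 - M) + \<epsilon>) * real F" .
      qed simp
      finally show ?thesis .
    qed
    ultimately show "\<exists>\<phi> \<psi> \<mu>.
     (\<forall>k\<in>{1..K}. real (card (\<phi> k ` set_pmf (files_pmf N F))) \<le> 2 powr ((M + \<epsilon>) * real F)) \<and>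
     (\<forall>d\<in>demands N K. real (card (\<psi> d ` set_pmf (files_pmf N F)))
        \<le> 2 powr ((real N * (1 - M) + \<epsilon>) * real F)) \<and>
     error_prob N K F \<phi> \<psi> \<mu> < \<epsilon>"
      using scheme(3) \<open>\<epsilon> > 0\<close> by (intro exI[of _ \<phi>] exI[of _ \<psi>] exI[of _ \<mu>]) auto
  qed
qed

theorem theorem2:
  fixes N K :: nat
  assumes "N \<ge> 1" and "K > N"
  shows "achievable N K (1 / real K) (real N - real N / real K) \<and>
         (\<forall>M\<in>{0..1 / real K}. achievable N K M (real N * (1 - M)))"
proof -
  have "\<forall>M\<in>{0..1 / real K}. achievable N K M (real N * (1 - M))"
    using achievable_small_cache assms by simp
  \<comment> \<open>The first pair is the endpoint M = 1/K of the segment.\<close>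
  moreover from this have "achievable N K (1 / real K) (real N * (1 - 1 / real K))"
    by simp
  ultimately show ?thesis
    by (simp add: right_diff_distrib)
qed

end
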